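(* For every integer $n \geq 2$, $$ T_n = \frac{1}{n^2} \sum_{j|n} (\varphi(j))^2 \, j^{\frac{n}{j}} \Big( \frac{n}{j} \Big)! $$
   Context: $\mathscr{S}_n$ is the group of all permutations of $\{1,\ldots,n\}$, $\mathscr{C}_n \subset \mathscr{S}_n$ is the set of all $n$-cycles, and $\mathscr{R}_n$ is the cyclic subgroup of $\mathscr{S}_n$ generated by $\rho=(1\,2\,\cdots\,n)$. The group $\mathscr{R}_n$ acts on $\mathscr{C}_n$ by conjugation; each orbit of this action is called a combinatorial type in $\mathscr{C}_n$. $T_n$ denotes the number of distinct combinatorial types in $\mathscr{C}_n$. $\varphi$ is Euler's totient function, and the sum is over positive divisors $j$ of $n$. *)

theory Defs
  imports
    "HOL-Combinatorics.Cycles"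
    "HOL-Algebra.Generated_Groups"
    "HOL-Algebra.Group_Action"
    "HOL-Algebra.Sym_Groups"
    "HOL-Number_Theory.Totient"
begin

text \<open>Permutations are composed from right to left, and
  \<open>cycle_of_list [a, b, c]\<close> maps \<open>a\<close> to \<open>b\<close>, \<open>b\<close> to \<open>c\<close> and \<open>c\<close> to \<open>a\<close>.\<close>

definition n_cycles :: "nat \<Rightarrow> (nat \<Rightarrow> nat) set" where
  "n_cycles n = {p \<in> carrier (sym_group n).
     \<exists>cs. cycle cs \<and> length cs = n \<and> set cs \<subseteq> {1..n} \<and> p = cycle_of_list cs}"

definition rho :: "nat \<Rightarrow> nat \<Rightarrow> nat" where
  "rho n = cycle_of_list [1..<Suc n]"

definition rotation_group :: "nat \<Rightarrow> (nat \<Rightarrow> nat) monoid" where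
  "rotation_group n = (sym_group n)\<lparr>carrier := generate (sym_group n) {rho n}\<rparr>"

text \<open>The restriction to \<open>n_cycles n\<close> only fixes the junk value outside the set acted on,
  as the library's \<^const>\<open>group_action\<close> requires.\<close>

definition conj_action :: "nat \<Rightarrow> (nat \<Rightarrow> nat) \<Rightarrow> (nat \<Rightarrow> nat) \<Rightarrow> nat \<Rightarrow> nat" where
  "conj_action n g = (\<lambda>c\<in>n_cycles n. g \<otimes>\<^bsub>sym_group n\<^esub> c \<otimes>\<^bsub>sym_group n\<^esub> inv\<^bsub>sym_group n\<^esub> g)"

definition combinatorial_types :: "nat \<Rightarrow> (nat \<Rightarrow> nat) set set" where
  "combinatorial_types n = orbits (rotation_group n) (n_cycles n) (conj_action n)"

definition num_types :: "nat \<Rightarrow> nat" where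
  "num_types n = card (combinatorial_types n)"

lemma rho_in_sym_group: "rho n \<in> carrier (sym_group n)"
proof -
  have "rho n permutes set [1..<Suc n]"
    unfolding rho_def by (rule cycle_permutes)
  moreover have "set [1..<Suc n] = {1..n}" by auto
  ultimately show ?thesis by (simp only: sym_group_carrier)
qed

lemma rotation_subgroup: "subgroup (generate (sym_group n) {rho n}) (sym_group n)"
  by (simp add: group.generate_is_subgroup sym_group_is_group rho_in_sym_group)

lemma group_rotation_group: "group (rotation_group n)"
  unfolding rotation_group_def
  by (rule subgroup.subgroup_is_group[OF rotation_subgroup sym_group_is_group])

lemma conj_n_cycle:
  assumes "g \<in> carrier (sym_group n)" "c \<in> n_cycles n"
  shows "g \<otimes>\<^bsub>sym_group n\<^esub> c \<otimes>\<^bsub>sym_group n\<^esub> inv\<^bsub>sym_group n\<^esub> g \<in> n_cycles n"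
proof -
  interpret S: group "sym_group n" by (rule sym_group_is_group)
  from assms(2) obtain cs where cs: "c \<in> carrier (sym_group n)" "cycle cs" "length cs = n"
      "set cs \<subseteq> {1..n}" "c = cycle_of_list cs"
    unfolding n_cycles_def by auto
  from assms(1) have g: "g permutes {1..n}" by (simp add: sym_group_carrier)
  have "g \<otimes>\<^bsub>sym_group n\<^esub> c \<otimes>\<^bsub>sym_group n\<^esub> inv\<^bsub>sym_group n\<^esub> g = cycle_of_list (map g cs)"
    using conjugation_of_cycle[OF cs(2) permutes_bij[OF g]] cs(5)
    by (simp add: sym_group_mult sym_group_inv_equality[OF assms(1)])
  moreover have "cycle (map g cs)"
    using cs(2) permutes_inj[OF g] by (simp add: distinct_map inj_on_def)
  moreover have "set (map g cs) \<subseteq> {1..n}"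
    using cs(4) permutes_in_image[OF g] by auto
  moreover have "g \<otimes>\<^bsub>sym_group n\<^esub> c \<otimes>\<^bsub>sym_group n\<^esub> inv\<^bsub>sym_group n\<^esub> g \<in> carrier (sym_group n)"
    using assms(1) cs(1) by (simp del: sym_group_inv_equality)
  ultimately show ?thesis
    unfolding n_cycles_def using cs(3) by (auto intro!: exI[of _ "map g cs"])
qed

lemma conj_action_is_group_action:
  "group_action (rotation_group n) (n_cycles n) (conj_action n)"
proof -
  interpret S: group "sym_group n" by (rule sym_group_is_group)
  interpret R: group "rotation_group n" by (rule group_rotation_group)
  let ?S = "sym_group n" and ?C = "n_cycles n"
  have sub: "g \<in> carrier ?S" if "g \<in> carrier (rotation_group n)" for g
    using that subgroup.subset[OF rotation_subgroup] by (auto simp: rotation_group_def)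
  have CS: "c \<in> carrier ?S" if "c \<in> ?C" for c using that by (simp add: n_cycles_def)
  have closed: "conj_action n g c \<in> ?C" if "g \<in> carrier ?S" "c \<in> ?C" for g c
    using conj_n_cycle[OF that] that by (simp add: conj_action_def)
  have comp: "conj_action n (g \<otimes>\<^bsub>?S\<^esub> h) c = conj_action n g (conj_action n h c)"
    if "g \<in> carrier ?S" "h \<in> carrier ?S" "c \<in> ?C" for g h c
    using that conj_n_cycle[OF that(2,3)] CS[OF that(3)]
    by (simp add: conj_action_def S.inv_mult_group S.m_assoc del: sym_group_inv_equality)
  have one: "conj_action n \<one>\<^bsub>?S\<^esub> c = c" if "c \<in> ?C" for c
    using that CS[OF that] by (simp add: conj_action_def)
  have bij: "conj_action n g \<in> Bij ?C" if g: "g \<in> carrier ?S" for g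
  proof -
    have "bij_betw (conj_action n g) ?C ?C"
      by (rule bij_betw_byWitness[where f' = "conj_action n (inv\<^bsub>?S\<^esub> g)"])
        (use g closed one in \<open>auto simp: comp[symmetric] simp del: sym_group_inv_equality\<close>)
    then show ?thesis by (simp add: Bij_def conj_action_def)
  qed
  have "conj_action n \<in> hom (rotation_group n) (BijGroup ?C)"
  proof (rule homI)
    fix g assume "g \<in> carrier (rotation_group n)"
    then show "conj_action n g \<in> carrier (BijGroup ?C)" by (simp add: BijGroup_def bij sub)
  next
    fix g h assume gh: "g \<in> carrier (rotation_group n)" "h \<in> carrier (rotation_group n)"
    have m: "g \<otimes>\<^bsub>rotation_group n\<^esub> h = g \<otimes>\<^bsub>?S\<^esub> h" by (simp add: rotation_group_def)
    have "conj_action n (g \<otimes>\<^bsub>?S\<^esub> h) = compose ?C (conj_action n g) (conj_action n h)"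
    proof (rule extensionalityI[where A = ?C])
      show "conj_action n (g \<otimes>\<^bsub>?S\<^esub> h) \<in> extensional ?C" by (simp add: conj_action_def)
    qed (use gh sub comp in \<open>auto simp: compose_eq\<close>)
    then show "conj_action n (g \<otimes>\<^bsub>rotation_group n\<^esub> h) =
        conj_action n g \<otimes>\<^bsub>BijGroup ?C\<^esub> conj_action n h"
      using gh sub bij by (simp add: m BijGroup_def)
  qed
  then show ?thesis
    by (intro group_action.intro group_hom.intro group_hom_axioms.intro
        R.group_axioms group_BijGroup)
qed

end

theory Submission
  imports Defs "HOL-Algebra.Multiplicative_Group"
begin

text \<open>
  Burnside's lemma gives \<open>n * T\<^sub>n = \<Sum>k<n. fix (\<rho> ^ k)\<close>, where \<open>fix g\<close> is the number of
  \<open>n\<close>-cycles that commute with \<open>g\<close>.  Write \<open>Z = {..<n}\<close> for the residues modulo \<open>n\<close>.  Labelling an \<open>n\<close>-cycle \<open>c\<close>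
  from a starting point is the same as giving a bijection \<open>f\<close> from \<open>Z\<close> to \<open>{1..n}\<close> with
  \<open>f (x + 1) = c (f x)\<close>; each cycle has \<open>n\<close> labellings, and \<open>f\<close> determines \<open>c\<close>.  Transported
  along \<open>f\<close>, a permutation \<open>g\<close> commutes with \<open>c\<close> exactly if it becomes a permutation of \<open>Z\<close> that
  commutes with \<open>x \<mapsto> x + 1\<close>, that is, a translation \<open>x \<mapsto> x + a\<close>.  Hence
  \<open>n * fix g\<close> is the number of pairs \<open>(a, f)\<close> with \<open>f (x + a) = g (f x)\<close> for all \<open>x\<close>
  (\<open>card_commuting_n_cycles\<close>).

  So \<open>n\<^sup>2 * T\<^sub>n\<close> is the sum, over all pairs \<open>(k, a)\<close> of residues, of the number of bijections
  intertwining the translation by \<open>a\<close> with \<open>\<rho> ^ k\<close>.  All cycles of the translation by \<open>a\<close> have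
  length equal to the order of \<open>a\<close>, and all cycles of \<open>\<rho> ^ k\<close> have length equal to the order of
  \<open>k\<close>.  If the two orders differ there is no intertwining bijection; if both equal \<open>j\<close>, there
  are \<open>j ^ (n / j) * (n / j)!\<close> of them (\<open>card_intertwiners\<close>): match up the \<open>n / j\<close> cycles, and
  choose a rotation for each.  Since \<open>\<phi> j\<close> residues have order \<open>j\<close>
  (\<open>sum_residues_by_order\<close>), there are \<open>(\<phi> j)\<^sup>2\<close> pairs for each divisor \<open>j\<close>, which is the
  formula.
\<close>

section \<open>Bijections intertwining two maps with cycles of equal length\<close>

text \<open>Every cycle of \<open>\<alpha>\<close> on \<open>A\<close> has length exactly \<open>j\<close>.  The condition by divisibility
  makes it immediate how powers of \<open>\<alpha>\<close> and conjugates of \<open>\<alpha>\<close> behave; for \<open>j = 0\<close> it says that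
  all orbits are infinite.\<close>

definition uniform_cycles :: "nat \<Rightarrow> ('a \<Rightarrow> 'a) \<Rightarrow> 'a set \<Rightarrow> bool" where
  "uniform_cycles j \<alpha> A \<longleftrightarrow> \<alpha> \<in> A \<rightarrow> A \<and> (\<forall>x\<in>A. \<forall>i. (\<alpha> ^^ i) x = x \<longleftrightarrow> j dvd i)"

text \<open>Extensionality makes such a bijection determined by its values on \<open>A\<close>, so that the set can
  be counted.\<close>

definition intertwiners ::
    "('a \<Rightarrow> 'a) \<Rightarrow> 'a set \<Rightarrow> ('b \<Rightarrow> 'b) \<Rightarrow> 'b set \<Rightarrow> ('a \<Rightarrow> 'b) set" where
  "intertwiners \<alpha> A \<beta> B =
     {f \<in> extensional A. bij_betw f A B \<and> (\<forall>x\<in>A. f (\<alpha> x) = \<beta> (f x))}"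

lemma funpow_closed:
  assumes "\<alpha> \<in> A \<rightarrow> A" "x \<in> A"
  shows "(\<alpha> ^^ i) x \<in> A"
  using assms by (induction i) auto

lemma intertwiner_funpow:
  assumes "f \<in> intertwiners \<alpha> A \<beta> B" "\<alpha> \<in> A \<rightarrow> A" "x \<in> A"
  shows "f ((\<alpha> ^^ i) x) = (\<beta> ^^ i) (f x)"
  using assms funpow_closed[OF assms(2,3)] by (induction i) (auto simp: intertwiners_def)

text \<open>An intertwining bijection maps each cycle of \<open>\<alpha>\<close> onto a cycle of \<open>\<beta>\<close> of the same length.\<close>

lemma intertwiner_same_cycle_length:
  assumes "f \<in> intertwiners \<alpha> A \<beta> B" "A \<noteq> {}"
    and "uniform_cycles j \<alpha> A" "uniform_cycles k \<beta> B"
  shows "j = k"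
proof -
  obtain x where x: "x \<in> A" using assms(2) by auto
  have al: "\<alpha> \<in> A \<rightarrow> A" using assms(3) by (simp add: uniform_cycles_def)
  have fx: "f x \<in> B" and inj: "inj_on f A"
    using assms(1) x by (auto simp: intertwiners_def bij_betw_def)
  have "j dvd i \<longleftrightarrow> k dvd i" for i
  proof -
    have "j dvd i \<longleftrightarrow> (\<alpha> ^^ i) x = x" using assms(3) x by (simp add: uniform_cycles_def)
    also have "\<dots> \<longleftrightarrow> f ((\<alpha> ^^ i) x) = f x"
      using inj_on_eq_iff[OF inj funpow_closed[OF al x] x] by simp
    also have "\<dots> \<longleftrightarrow> k dvd i"
      using assms(4) fx by (simp add: intertwiner_funpow[OF assms(1) al x] uniform_cycles_def)
    finally show ?thesis .
  qed
  then show ?thesis by (meson dvd_antisym dvd_refl)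
qed

lemma uniform_cycles_transport:
  assumes "f \<in> intertwiners \<alpha> A \<beta> B" "uniform_cycles j \<alpha> A"
  shows "uniform_cycles j \<beta> B"
proof -
  have al: "\<alpha> \<in> A \<rightarrow> A" using assms(2) by (simp add: uniform_cycles_def)
  have bij: "bij_betw f A B" and eq: "\<And>x. x \<in> A \<Longrightarrow> f (\<alpha> x) = \<beta> (f x)"
    using assms(1) by (auto simp: intertwiners_def)
  have B: "B = f ` A" and inj: "inj_on f A" using bij by (auto simp: bij_betw_def)
  have "(\<beta> ^^ i) (f x) = f x \<longleftrightarrow> j dvd i" if x: "x \<in> A" for x i
    using inj_on_eq_iff[OF inj funpow_closed[OF al x] x] assms(2) x
    by (simp add: intertwiner_funpow[OF assms(1) al x] uniform_cycles_def)
  then show ?thesis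
    using al eq unfolding uniform_cycles_def B by (auto simp: Pi_iff simp flip: eq)
qed

lemma funpow_eq_iff_mod:
  assumes "uniform_cycles j \<alpha> A" "j > 0" "x \<in> A"
  shows "(\<alpha> ^^ i) x = (\<alpha> ^^ k) x \<longleftrightarrow> i mod j = k mod j"
proof -
  have al: "\<alpha> \<in> A \<rightarrow> A" and per: "\<And>y i. y \<in> A \<Longrightarrow> (\<alpha> ^^ i) y = y \<longleftrightarrow> j dvd i"
    using assms(1) by (auto simp: uniform_cycles_def)
  have red: "(\<alpha> ^^ i) x = (\<alpha> ^^ (i mod j)) x" for i
  proof -
    have "(\<alpha> ^^ i) x = (\<alpha> ^^ (i mod j)) ((\<alpha> ^^ (j * (i div j))) x)"
      by (metis comp_apply funpow_add mod_mult_div_eq)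
    moreover have "(\<alpha> ^^ (j * (i div j))) x = x"
      using per[OF assms(3), of "j * (i div j)"] by simp
    ultimately show ?thesis by simp
  qed
  have le: "i = k" if "i \<le> k" "k < j" "(\<alpha> ^^ i) x = (\<alpha> ^^ k) x" for i k
  proof -
    have "(\<alpha> ^^ (k - i)) ((\<alpha> ^^ i) x) = (\<alpha> ^^ i) x"
      using that by (metis comp_apply funpow_add le_add_diff_inverse2)
    then have "j dvd k - i" using per funpow_closed[OF al assms(3)] by blast
    then show ?thesis using that by (auto dest: dvd_imp_le)
  qed
  show ?thesis
  proof
    assume "(\<alpha> ^^ i) x = (\<alpha> ^^ k) x"
    then have "(\<alpha> ^^ (i mod j)) x = (\<alpha> ^^ (k mod j)) x" using red by metis
    then show "i mod j = k mod j"
      using le[of "i mod j" "k mod j"] le[of "k mod j" "i mod j"] assms(2)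
      by (metis mod_less_divisor nat_le_linear)
  next
    assume "i mod j = k mod j"
    then show "(\<alpha> ^^ i) x = (\<alpha> ^^ k) x" using red by metis
  qed
qed

lemma uniform_cycles_remove_cycle:
  assumes "uniform_cycles j \<alpha> A" "j > 0" "x \<in> A"
  defines "C \<equiv> range (\<lambda>i. (\<alpha> ^^ i) x)"
  shows "C \<subseteq> A" "\<alpha> \<in> C \<rightarrow> C" "finite C" "card C = j" "uniform_cycles j \<alpha> (A - C)"
proof -
  have al: "\<alpha> \<in> A \<rightarrow> A" and per: "\<And>y i. y \<in> A \<Longrightarrow> (\<alpha> ^^ i) y = y \<longleftrightarrow> j dvd i"
    using assms(1) by (auto simp: uniform_cycles_def)
  show "C \<subseteq> A" using funpow_closed[OF al assms(3)] by (auto simp: C_def)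
  show CC: "\<alpha> \<in> C \<rightarrow> C" 
  proof
    fix y assume "y \<in> C"
    then obtain i where "y = (\<alpha> ^^ i) x" by (auto simp: C_def)
    then have "\<alpha> y = (\<alpha> ^^ Suc i) x" by simp
    then show "\<alpha> y \<in> C" unfolding C_def by blast
  qed
  have C: "C = (\<lambda>i. (\<alpha> ^^ i) x) ` {..<j}"
  proof
    show "C \<subseteq> (\<lambda>i. (\<alpha> ^^ i) x) ` {..<j}"
    proof
      fix y assume "y \<in> C"
      then obtain i where "y = (\<alpha> ^^ i) x" by (auto simp: C_def)
      then have "y = (\<alpha> ^^ (i mod j)) x" using funpow_eq_iff_mod[OF assms(1-3)] by simp
      then show "y \<in> (\<lambda>i. (\<alpha> ^^ i) x) ` {..<j}" using assms(2) by auto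
    qed
  qed (auto simp: C_def)
  have "inj_on (\<lambda>i. (\<alpha> ^^ i) x) {..<j}"
    using funpow_eq_iff_mod[OF assms(1-3)] by (auto simp: inj_on_def)
  then show "card C = j" "finite C" unfolding C by (simp_all add: card_image)
  have "\<alpha> z \<notin> C" if "z \<in> A - C" for z
  proof
    assume "\<alpha> z \<in> C"
    then have "(\<alpha> ^^ (j - 1)) (\<alpha> z) \<in> C" using funpow_closed[OF CC] by blast
    moreover have "(\<alpha> ^^ (j - 1)) (\<alpha> z) = (\<alpha> ^^ j) z"
      using assms(2) by (metis Suc_diff_1 comp_apply funpow_Suc_right)
    ultimately show False using per[of z j] that by auto
  qed
  then show "uniform_cycles j \<alpha> (A - C)" using al per by (auto simp: uniform_cycles_def)
qed

text \<open>The value at \<open>x\<close> forces the values on the whole cycle of \<open>x\<close>, by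
  \<open>f (\<alpha> ^ i x) = \<beta> ^ i y\<close>, and this prescription is consistent because the two cycles have the same
  length.  What remains to be chosen is an intertwining bijection between the complements.\<close>

lemma intertwiners_with_given_value:
  assumes \<alpha>: "uniform_cycles j \<alpha> A" and \<beta>: "uniform_cycles j \<beta> B" and j: "j > 0"
    and x: "x \<in> A" and y: "y \<in> B"
  defines "C \<equiv> range (\<lambda>i. (\<alpha> ^^ i) x)" and "D \<equiv> range (\<lambda>i. (\<beta> ^^ i) y)"
  shows "bij_betw (\<lambda>f. restrict f (A - C)) {f \<in> intertwiners \<alpha> A \<beta> B. f x = y}
    (intertwiners \<alpha> (A - C) \<beta> (B - D))"
proof -
  have al: "\<alpha> \<in> A \<rightarrow> A" using \<alpha> by (simp add: uniform_cycles_def)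
  note C = uniform_cycles_remove_cycle[OF \<alpha> j x, folded C_def]
  note D = uniform_cycles_remove_cycle[OF \<beta> j y, folded D_def]
  have al': "\<alpha> z \<in> A - C" if "z \<in> A - C" for z using C(5) that by (auto simp: uniform_cycles_def)
  have onC: "f ((\<alpha> ^^ i) x) = (\<beta> ^^ i) y" if "f \<in> intertwiners \<alpha> A \<beta> B" "f x = y" for f i
    using intertwiner_funpow[OF that(1) al x] that(2) by simp
  \<comment> \<open>The forced bijection from the cycle of \<open>x\<close> to the cycle of \<open>y\<close>; any exponent reaching \<open>z\<close>
    gives the same value.\<close>
  define h where "h = (\<lambda>z. (\<beta> ^^ (SOME i. (\<alpha> ^^ i) x = z)) y)"
  have h: "h ((\<alpha> ^^ i) x) = (\<beta> ^^ i) y" for i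
  proof -
    have "(\<alpha> ^^ (SOME k. (\<alpha> ^^ k) x = (\<alpha> ^^ i) x)) x = (\<alpha> ^^ i) x" by (rule someI) (rule refl)
    then show ?thesis
      unfolding h_def by (simp add: funpow_eq_iff_mod[OF \<alpha> j x] funpow_eq_iff_mod[OF \<beta> j y])
  qed
  have hbij: "bij_betw h C D"
  proof (rule bij_betw_imageI)
    show "inj_on h C"
      by (auto simp: inj_on_def C_def h funpow_eq_iff_mod[OF \<alpha> j x] funpow_eq_iff_mod[OF \<beta> j y])
    show "h ` C = D" by (auto simp: C_def D_def h image_image)
  qed
  show ?thesis
  proof (rule bij_betw_imageI)
    show "inj_on (\<lambda>f. restrict f (A - C)) {f \<in> intertwiners \<alpha> A \<beta> B. f x = y}"
    proof (rule inj_onI)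
      fix f g assume f: "f \<in> {f \<in> intertwiners \<alpha> A \<beta> B. f x = y}"
        and g: "g \<in> {f \<in> intertwiners \<alpha> A \<beta> B. f x = y}"
        and eq: "restrict f (A - C) = restrict g (A - C)"
      show "f = g"
      proof (rule extensionalityI[where A = A])
        fix z assume z: "z \<in> A"
        show "f z = g z"
        proof (cases "z \<in> C")
          case True
          then obtain i where "z = (\<alpha> ^^ i) x" by (auto simp: C_def)
          then show ?thesis using f g onC[of f i] onC[of g i] by simp
        next
          case False
          then show ?thesis using eq z by (metis DiffI restrict_apply')
        qed
      qed (use f g in \<open>auto simp: intertwiners_def\<close>)
    qed
    show "(\<lambda>f. restrict f (A - C)) ` {f \<in> intertwiners \<alpha> A \<beta> B. f x = y} =
        intertwiners \<alpha> (A - C) \<beta> (B - D)" (is "?r ` ?F = ?I")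
    proof
      show "?r ` ?F \<subseteq> ?I"
      proof
        fix g assume "g \<in> ?r ` ?F"
        then obtain f where f: "f \<in> intertwiners \<alpha> A \<beta> B" "f x = y" and g: "g = ?r f" by auto
        have "f ` C = D" by (auto simp: C_def D_def onC[OF f] image_image)
        then have "bij_betw f (A - C) (B - D)"
          using f(1) C(1) inj_on_image_set_diff[of f A A C]
          by (simp add: intertwiners_def bij_betw_def inj_on_diff)
        then have "bij_betw g (A - C) (B - D)" by (simp add: g bij_betw_restrict_eq)
        then show "g \<in> ?I" using f(1) al' by (auto simp: intertwiners_def g)
      qed
      show "?I \<subseteq> ?r ` ?F"
      proof
        fix g assume g: "g \<in> ?I"
        define f where "f = (\<lambda>z. if z \<in> C then h z else g z)"
        have "bij_betw f C D" using hbij by (subst bij_betw_cong[of _ _ h]) (auto simp: f_def)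
        moreover have "bij_betw f (A - C) (B - D)"
          using g by (subst bij_betw_cong[of _ _ g]) (auto simp: f_def intertwiners_def)
        ultimately have "bij_betw f (C \<union> (A - C)) (D \<union> (B - D))"
          by (rule bij_betw_combine) auto
        then have bij: "bij_betw f A B" using C(1) D(1) by (simp add: Un_absorb1)
        have "f (\<alpha> z) = \<beta> (f z)" if z: "z \<in> A" for z
        proof (cases "z \<in> C")
          case True
          then obtain i where i: "z = (\<alpha> ^^ i) x" by (auto simp: C_def)
          have "\<alpha> z \<in> C" using True C(2) by auto
          then show ?thesis using True h[of i] h[of "Suc i"] by (simp add: f_def i)
        next
          case False
          then show ?thesis using z al'[of z] g by (auto simp: f_def intertwiners_def)
        qed
        moreover have "f \<in> extensional A"
          using g C(1) by (auto simp: f_def intertwiners_def extensional_def)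
        moreover have "f x = y"
          using h[of 0] rangeI[of "\<lambda>i. (\<alpha> ^^ i) x" 0] by (simp add: f_def C_def)
        moreover have "g = ?r f"
          using g by (auto simp: f_def intertwiners_def extensional_def fun_eq_iff)
        ultimately show "g \<in> ?r ` ?F" using bij by (auto simp: intertwiners_def)
      qed
    qed
  qed
qed

lemma finite_intertwiners:
  assumes "finite A" "finite B"
  shows "finite (intertwiners \<alpha> A \<beta> B)"
proof (rule finite_subset)
  show "intertwiners \<alpha> A \<beta> B \<subseteq> A \<rightarrow>\<^sub>E B"
    by (auto simp: intertwiners_def PiE_def dest: bij_betwE)
qed (use assms in \<open>simp add: finite_PiE\<close>)

text \<open>Fix a point \<open>x\<close>.  There are \<open>j * m\<close> choices for its image, and each leaves the same problem
  with one cycle fewer, so the count is \<open>(j * m) * (j * (m - 1)) * \<dots> * j\<close>.\<close>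

lemma card_intertwiners:
  assumes "uniform_cycles j \<alpha> A" "uniform_cycles j \<beta> B" "j > 0"
    and "finite A" "finite B" "card A = j * m" "card B = j * m"
  shows "card (intertwiners \<alpha> A \<beta> B) = j ^ m * fact m"
  using assms
proof (induction m arbitrary: A B)
  case 0
  then have "A = {}" "B = {}" by auto
  then have "intertwiners \<alpha> A \<beta> B = {\<lambda>x. undefined}"
    by (auto simp: intertwiners_def bij_betw_def)
  then show ?case by simp
next
  case (Suc m)
  have "A \<noteq> {}" using Suc.prems by auto
  then obtain x where x: "x \<in> A" by auto
  have fibre: "card {f \<in> intertwiners \<alpha> A \<beta> B. f x = y} = j ^ m * fact m" if y: "y \<in> B" for y
  proof -
    let ?C = "range (\<lambda>i. (\<alpha> ^^ i) x)" and ?D = "range (\<lambda>i. (\<beta> ^^ i) y)"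
    note C = uniform_cycles_remove_cycle[OF Suc.prems(1,3) x]
    note D = uniform_cycles_remove_cycle[OF Suc.prems(2,3) y]
    have "card {f \<in> intertwiners \<alpha> A \<beta> B. f x = y} =
        card (intertwiners \<alpha> (A - ?C) \<beta> (B - ?D))"
      by (rule bij_betw_same_card[OF intertwiners_with_given_value[OF Suc.prems(1-3) x y]])
    also have "\<dots> = j ^ m * fact m"
      using Suc.prems C D by (intro Suc.IH) (auto simp: card_Diff_subset)
    finally show ?thesis .
  qed
  have "intertwiners \<alpha> A \<beta> B = (\<Union>y\<in>B. {f \<in> intertwiners \<alpha> A \<beta> B. f x = y})"
    using x by (auto simp: intertwiners_def dest: bij_betwE)
  then have "card (intertwiners \<alpha> A \<beta> B) =
      (\<Sum>y\<in>B. card {f \<in> intertwiners \<alpha> A \<beta> B. f x = y})"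
    using Suc.prems(4,5) finite_intertwiners[OF Suc.prems(4,5)]
    by (subst card_UN_disjoint[symmetric]) auto
  also have "\<dots> = card B * (j ^ m * fact m)" by (simp add: fibre)
  also have "\<dots> = j ^ Suc m * fact (Suc m)" using Suc.prems by (simp add: algebra_simps)
  finally show ?case .
qed

section \<open>Translations of the residues modulo n\<close>

definition shift :: "nat \<Rightarrow> nat \<Rightarrow> nat \<Rightarrow> nat" where
  "shift n a x = (x + a) mod n"

lemma shift_funpow: "x < n \<Longrightarrow> (shift n a ^^ i) x = (x + i * a) mod n"
  by (induction i) (auto simp: shift_def mod_simps algebra_simps)

lemma shift_closed: "n > 0 \<Longrightarrow> shift n a \<in> {..<n} \<rightarrow> {..<n}"
  by (simp add: shift_def)

text \<open>The additive order of \<open>a\<close> modulo \<open>n\<close> is \<open>n div gcd n a\<close>, hence so is the length of every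
  cycle of the translation by \<open>a\<close>.\<close>

lemma dvd_mult_iff_div_gcd_dvd:
  fixes n a i :: nat
  assumes "n > 0"
  shows "n dvd i * a \<longleftrightarrow> n div gcd n a dvd i"
proof -
  define g where "g = gcd n a"
  have g: "g > 0" "g * (n div g) = n" "g * (a div g) = a" using assms by (auto simp: g_def)
  have cop: "coprime (n div g) (a div g)"
    unfolding g_def using assms by (intro div_gcd_coprime) auto
  have "i * a = g * (i * (a div g))" using g(3) by (metis mult.left_commute)
  then have "n dvd i * a \<longleftrightarrow> g * (n div g) dvd g * (i * (a div g))" by (simp only: g(2))
  also have "\<dots> \<longleftrightarrow> n div g dvd i"
    using g(1) cop by (simp only: nat_mult_dvd_cancel1 coprime_dvd_mult_left_iff)
  finally show ?thesis by (simp add: g_def)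
qed

lemma mod_add_eq_self_iff:
  fixes x n b :: nat
  assumes "x < n"
  shows "(x + b) mod n = x \<longleftrightarrow> n dvd b"
proof -
  have "(x + b) mod n = x \<longleftrightarrow> [x + b = x + 0] (mod n)" using assms by (simp add: cong_def)
  also have "\<dots> \<longleftrightarrow> n dvd b" by (simp only: cong_add_lcancel_nat cong_0_iff)
  finally show ?thesis .
qed

lemma div_dvd_self: "d dvd n \<Longrightarrow> n div d dvd (n :: nat)"
  by (metis dvd_div_mult_self dvd_triv_left)

lemma uniform_cycles_shift:
  assumes "n > 0"
  shows "uniform_cycles (n div gcd n a) (shift n a) {..<n}"
  using shift_closed[OF assms]
  by (simp add: uniform_cycles_def shift_funpow mod_add_eq_self_iff dvd_mult_iff_div_gcd_dvd[OF assms])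

section \<open>Labellings of n-cycles\<close>

lemma cycle_of_list_nth:
  assumes "cycle cs" "i < length cs"
  shows "cycle_of_list cs (cs ! i) = cs ! (Suc i mod length cs)"
proof -
  have "cycle_of_list cs (cs ! i) = map (cycle_of_list cs) cs ! i" using assms by simp
  also have "map (cycle_of_list cs) cs = rotate 1 cs" using cyclic_rotation[OF assms(1), of 1] by simp
  also have "\<dots> ! i = cs ! (Suc i mod length cs)" using nth_rotate[OF assms(2), of 1] by simp
  finally show ?thesis .
qed

lemma nth_intertwines_cycle:
  assumes "cycle cs" "length cs = n"
  shows "restrict ((!) cs) {..<n} \<in> intertwiners (shift n 1) {..<n} (cycle_of_list cs) (set cs)"
proof -
  have "bij_betw ((!) cs) {..<n} (set cs)"
    using assms by (intro bij_betw_nth) auto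
  moreover have "Suc x mod n < n" if "x < n" for x using that by (intro mod_less_divisor) auto
  ultimately show ?thesis
    using assms
    by (auto simp: intertwiners_def bij_betw_restrict_eq shift_def cycle_of_list_nth)
qed

lemma intertwined_permutation_unique:
  assumes "f \<in> intertwiners \<alpha> A \<beta> B" "f \<in> intertwiners \<alpha> A \<gamma> B"
    and "\<beta> permutes B" "\<gamma> permutes B"
  shows "\<beta> = \<gamma>"
proof
  fix y
  show "\<beta> y = \<gamma> y"
  proof (cases "y \<in> B")
    case True
    then obtain x where "x \<in> A" "y = f x"
      using assms(1) by (auto simp: intertwiners_def bij_betw_def)
    then show ?thesis using assms(1,2) by (auto simp: intertwiners_def)
  next
    case False
    then show ?thesis using assms(3,4) by (simp add: permutes_not_in)
  qed
qed

text \<open>An \<open>n\<close>-cycle is a permutation conjugate, along a labelling of the points by residues, to the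
  translation by \<open>1\<close>; a list presenting the cycle is such a labelling.\<close>

lemma n_cycles_iff:
  "c \<in> n_cycles n \<longleftrightarrow>
    c permutes {1..n} \<and> (\<exists>f. f \<in> intertwiners (shift n 1) {..<n} c {1..n})"
proof
  assume "c \<in> n_cycles n"
  then obtain cs where cs: "c permutes {1..n}" "cycle cs" "length cs = n" "set cs \<subseteq> {1..n}"
      "c = cycle_of_list cs"
    by (auto simp: n_cycles_def sym_group_carrier)
  have "card (set cs) = card {1..n}" using cs(2,3) by (simp add: distinct_card)
  then have "set cs = {1..n}" using cs(4) by (intro card_subset_eq) auto
  then show "c permutes {1..n} \<and> (\<exists>f. f \<in> intertwiners (shift n 1) {..<n} c {1..n})"
    using nth_intertwines_cycle[OF cs(2,3)] cs(1,5) by auto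
next
  assume "c permutes {1..n} \<and> (\<exists>f. f \<in> intertwiners (shift n 1) {..<n} c {1..n})"
  then obtain f where c: "c permutes {1..n}" and f: "f \<in> intertwiners (shift n 1) {..<n} c {1..n}"
    by auto
  define cs where "cs = map f [0..<n]"
  have bij: "bij_betw f {..<n} {1..n}" using f by (simp add: intertwiners_def)
  have set: "set cs = {1..n}"
    using bij by (auto simp: cs_def bij_betw_def lessThan_atLeast0)
  have cs: "cycle cs" "length cs = n"
    using bij by (auto simp: cs_def distinct_map bij_betw_def lessThan_atLeast0)
  have "f = restrict ((!) cs) {..<n}"
    using f by (intro extensionalityI[where A = "{..<n}"]) (auto simp: intertwiners_def cs_def)
  then have "f \<in> intertwiners (shift n 1) {..<n} (cycle_of_list cs) {1..n}"
    using nth_intertwines_cycle[OF cs] set by simp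
  moreover have "cycle_of_list cs permutes {1..n}" using cycle_permutes[of cs] set by simp
  ultimately have "c = cycle_of_list cs" using intertwined_permutation_unique f c by metis
  then show "c \<in> n_cycles n"
    using c cs set by (auto simp: n_cycles_def sym_group_carrier)
qed

lemma finite_n_cycles: "finite (n_cycles n)"
  by (rule finite_subset[of _ "{p. p permutes {1..n}}"])
    (auto simp: n_cycles_iff finite_permutations)

lemma n_cycle_uniform:
  assumes "c \<in> n_cycles n" "n > 0"
  shows "uniform_cycles n c {1..n}"
  using assms uniform_cycles_transport uniform_cycles_shift[OF assms(2), of 1]
  by (force simp: n_cycles_iff)

text \<open>The labellings are the intertwining bijections between two maps with a single cycle of length
  \<open>n\<close>.\<close>

lemma card_labellings_of_n_cycle:
  assumes "c \<in> n_cycles n" "n > 0"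
  shows "card (intertwiners (shift n 1) {..<n} c {1..n}) = n"
  using card_intertwiners[of n "shift n 1" "{..<n}" c "{1..n}" 1]
    uniform_cycles_shift[OF assms(2), of 1] n_cycle_uniform[OF assms] assms(2)
  by simp

text \<open>Both sides count the labellings \<open>f\<close> along which \<open>g\<close> becomes a translation: on the left each
  comes with the cycle \<open>c\<close> that it labels, on the right with the amount \<open>a\<close> of the translation, and
  \<open>f\<close> determines either of them.\<close>

lemma card_commuting_n_cycles:
  assumes g: "g permutes {1..n}" and n: "n > 0"
  shows "n * card {c \<in> n_cycles n. g \<circ> c = c \<circ> g} =
    (\<Sum>a<n. card (intertwiners (shift n a) {..<n} g {1..n}))"
proof -
  let ?Z = "{..<n}" and ?S = "{1..n}"
  let ?P = "SIGMA c:{c \<in> n_cycles n. g \<circ> c = c \<circ> g}. intertwiners (shift n 1) ?Z c ?S"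
  let ?Q = "SIGMA a:?Z. intertwiners (shift n a) ?Z g ?S"
  note cl = shift_closed[OF n]
  have injP: "inj_on snd ?P"
    by (auto simp: inj_on_def n_cycles_iff dest: intertwined_permutation_unique)
  have injQ: "inj_on snd ?Q"
  proof (rule inj_onI)
    fix p q assume "p \<in> ?Q" "q \<in> ?Q" "snd p = snd q"
    then obtain a b f where p: "p = (a, f)" "a < n" "f \<in> intertwiners (shift n a) ?Z g ?S"
      and q: "q = (b, f)" "b < n" "f \<in> intertwiners (shift n b) ?Z g ?S" by auto
    have "f (shift n a 0) = g (f 0)" "f (shift n b 0) = g (f 0)"
      using p(3) q(3) n by (auto simp: intertwiners_def)
    then have "f a = f b" using p(2) q(2) by (simp add: shift_def)
    moreover have "inj_on f ?Z" using p(3) by (simp add: intertwiners_def bij_betw_def)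
    ultimately show "p = q" using p q by (simp add: inj_on_eq_iff)
  qed
  have img: "snd ` ?P = snd ` ?Q"
  proof (intro subset_antisym subsetI)
    fix f assume "f \<in> snd ` ?P"
    then obtain c where gc: "g \<circ> c = c \<circ> g" and f: "f \<in> intertwiners (shift n 1) ?Z c ?S" by auto
    have bij: "bij_betw f ?Z ?S" using f by (simp add: intertwiners_def)
    have "f 0 \<in> ?S" using bij_betwE[OF bij] n by blast
    then have "g (f 0) \<in> ?S" by (simp only: permutes_in_image[OF g])
    then have "g (f 0) \<in> f ` ?Z" by (simp only: bij_betw_imp_surj_on[OF bij])
    then obtain a where a: "a < n" "f a = g (f 0)" by (metis imageE lessThan_iff)
    \<comment> \<open>A map commuting with the translation by \<open>1\<close> is determined by its value at \<open>0\<close>, so the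
      residue \<open>a\<close> that labels \<open>g (f 0)\<close> is the amount of the translation.\<close>
    have comm: "(c ^^ i) (g y) = g ((c ^^ i) y)" for i y
      using fun_cong[OF gc] by (induction i) auto
    have "f (shift n a x) = g (f x)" if x: "x < n" for x
    proof -
      have "f (shift n a x) = f ((shift n 1 ^^ x) a)" using a by (simp add: shift_funpow shift_def add.commute)
      also have "\<dots> = (c ^^ x) (g (f 0))" using intertwiner_funpow[OF f cl, of a x] a by simp
      also have "\<dots> = g (f ((shift n 1 ^^ x) 0))"
        using intertwiner_funpow[OF f cl, of 0 x] n by (simp add: comm)
      also have "\<dots> = g (f x)" using x by (simp add: shift_funpow)
      finally show ?thesis .
    qed
    then have "f \<in> intertwiners (shift n a) ?Z g ?S" using f by (auto simp: intertwiners_def)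
    then show "f \<in> snd ` ?Q" using a by force
  next
    fix f assume "f \<in> snd ` ?Q"
    then obtain a where a: "a < n" and f: "f \<in> intertwiners (shift n a) ?Z g ?S" by auto
    have bij: "bij_betw f ?Z ?S" using f by (simp add: intertwiners_def)
    \<comment> \<open>The cycle labelled by \<open>f\<close>.\<close>
    define c where "c = (\<lambda>y. if y \<in> ?S then f (shift n 1 (inv_into ?Z f y)) else y)"
    have cf: "c (f x) = f (shift n 1 x)" if "x < n" for x
      using that bij_betwE[OF bij] bij_betw_inv_into_left[OF bij] by (auto simp: c_def)
    have "bij_betw (shift n 1) ?Z ?Z"
    proof -
      have "inj_on (shift n 1) ?Z"
      proof (rule inj_onI)
        fix x y assume xy: "x \<in> ?Z" "y \<in> ?Z" and "shift n 1 x = shift n 1 y"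
        then have "[x + 1 = y + 1] (mod n)" by (simp add: shift_def cong_def)
        then have "[x = y] (mod n)" by (simp only: cong_add_rcancel_nat)
        then show "x = y" using xy by (simp add: cong_def)
      qed
      then show ?thesis using cl[of 1] by (intro bij_betw_imageI endo_inj_surj) auto
    qed
    then have "bij_betw (f \<circ> shift n 1 \<circ> inv_into ?Z f) ?S ?S"
      by (intro bij_betw_trans[OF bij_betw_inv_into[OF bij]] bij_betw_trans[OF _ bij])
    then have "bij_betw c ?S ?S"
      by (subst bij_betw_cong[of _ _ "f \<circ> shift n 1 \<circ> inv_into ?Z f"]) (auto simp: c_def)
    then have cp: "c permutes ?S" by (rule bij_imp_permutes) (auto simp: c_def)
    have cI: "f \<in> intertwiners (shift n 1) ?Z c ?S" using f cf by (auto simp: intertwiners_def)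
    then have "c \<in> n_cycles n" using cp by (auto simp: n_cycles_iff)
    moreover have "g \<circ> c = c \<circ> g"
    proof
      fix y
      show "(g \<circ> c) y = (c \<circ> g) y"
      proof (cases "y \<in> ?S")
        case True
        then have "y \<in> f ` ?Z" by (simp only: bij_betw_imp_surj_on[OF bij])
        then obtain x where x: "x < n" "y = f x" by (metis imageE lessThan_iff)
        have gf: "g (f z) = f (shift n a z)" if "z < n" for z
          using f that by (simp add: intertwiners_def)
        have sx: "shift n b x < n" for b using n by (simp add: shift_def)
        have "shift n a (shift n 1 x) = shift n 1 (shift n a x)"
          by (simp add: shift_def mod_simps add_ac)
        then show ?thesis by (simp only: x(2) comp_apply cf[OF x(1)] gf[OF x(1)] cf[OF sx] gf[OF sx])
      next
        case False
        then show ?thesis using g cp by (simp add: permutes_not_in)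
      qed
    qed
    ultimately show "f \<in> snd ` ?P" using cI by force
  qed
  have "card ?P = card (snd ` ?P)" by (rule card_image[OF injP, symmetric])
  also have "\<dots> = card ?Q" unfolding img by (rule card_image[OF injQ])
  finally have "card ?P = card ?Q" .
  moreover have "card ?P =
      (\<Sum>c\<in>{c \<in> n_cycles n. g \<circ> c = c \<circ> g}. card (intertwiners (shift n 1) ?Z c ?S))"
    using finite_n_cycles[of n] by (intro card_SigmaI) (auto intro: finite_intertwiners)
  moreover have "\<dots> = (\<Sum>c\<in>{c \<in> n_cycles n. g \<circ> c = c \<circ> g}. n)"
    using n by (intro sum.cong refl card_labellings_of_n_cycle) auto
  moreover have "card ?Q = (\<Sum>a<n. card (intertwiners (shift n a) ?Z g ?S))"
    by (subst card_SigmaI) (auto simp: finite_intertwiners)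
  ultimately show ?thesis by (simp add: mult.commute)
qed

section \<open>Counting by orders of residues\<close>

text \<open>The sum groups the residues by their additive order; exactly \<open>totient j\<close> residues have
  order \<open>j\<close>.\<close>

lemma sum_residues_by_order:
  fixes F :: "nat \<Rightarrow> 'a :: comm_semiring_1"
  assumes "n > 0"
  shows "(\<Sum>k<n. F (n div gcd n k)) = (\<Sum>j | j dvd n. of_nat (totient j) * F j)"
proof -
  let ?ord = "\<lambda>k. n div gcd n k"
  \<comment> \<open>Replacing the residue \<open>0\<close> by \<open>n\<close> moves to the range on which totients are counted.\<close>
  have "(\<Sum>k<n. F (?ord k)) = (\<Sum>k\<in>{0<..n}. F (?ord k))"
    using assms
    by (intro sum.reindex_bij_witness[of _ "\<lambda>k. if k = n then 0 else k" "\<lambda>k. if k = 0 then n else k"])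
      auto
  also have "\<dots> = (\<Sum>j | j dvd n. \<Sum>k\<in>{k\<in>{0<..n}. ?ord k = j}. F (?ord k))"
    using assms by (intro sum.group[symmetric]) (auto simp: div_dvd_self)
  also have "\<dots> = (\<Sum>j | j dvd n. of_nat (totient j) * F j)"
  proof (rule sum.cong)
    fix j assume "j \<in> {j. j dvd n}"
    then have j: "j dvd n" by simp
    have "?ord k = j \<longleftrightarrow> gcd k n = n div j" for k
    proof -
      have "gcd k n * ?ord k = n" by (simp add: gcd.commute)
      moreover have "n div j * j = n" using j by simp
      ultimately show ?thesis using assms by (metis mult_cancel1 mult_cancel2 not_gr0 mult_0 mult_0_right)
    qed
    then have "card {k\<in>{0<..n}. ?ord k = j} = totient (n div (n div j))"
      using card_gcd_eq_totient[OF assms, of "n div j"] div_dvd_self[OF j] by simp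
    also have "n div (n div j) = j" using assms j by auto
    finally show "(\<Sum>k\<in>{k\<in>{0<..n}. ?ord k = j}. F (?ord k)) = of_nat (totient j) * F j" by simp
  qed simp
  finally show ?thesis .
qed

lemma card_intertwiners_shift:
  assumes "n > 0" "uniform_cycles k g {1..n}" "k dvd n"
  shows "card (intertwiners (shift n a) {..<n} g {1..n}) =
    (if n div gcd n a = k then k ^ (n div k) * fact (n div k) else 0)"
proof (cases "n div gcd n a = k")
  case True
  then show ?thesis
    using card_intertwiners[of k "shift n a" "{..<n}" g "{1..n}" "n div k"]
      uniform_cycles_shift[OF assms(1), of a] assms
    by (simp add: dvd_pos_nat)
next
  case False
  then have "intertwiners (shift n a) {..<n} g {1..n} = {}"
    using intertwiner_same_cycle_length[OF _ _ uniform_cycles_shift[OF assms(1), of a] assms(2)] assms(1)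
    by auto
  then show ?thesis using False by simp
qed

lemma card_commuting_n_cycles_uniform:
  assumes "n > 0" "g permutes {1..n}" "uniform_cycles k g {1..n}" "k dvd n"
  shows "n * card {c \<in> n_cycles n. g \<circ> c = c \<circ> g} = totient k * (k ^ (n div k) * fact (n div k))"
proof -
  have "n * card {c \<in> n_cycles n. g \<circ> c = c \<circ> g} =
      (\<Sum>a<n. if n div gcd n a = k then k ^ (n div k) * fact (n div k) else 0)"
    unfolding card_commuting_n_cycles[OF assms(2,1)] card_intertwiners_shift[OF assms(1,3,4)] ..
  also have "\<dots> = (\<Sum>j | j dvd n. totient j * (if j = k then k ^ (n div k) * fact (n div k) else 0))"
    using sum_residues_by_order[OF assms(1), of "\<lambda>j. if j = k then k ^ (n div k) * fact (n div k) else 0"]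
    by simp
  also have "\<dots> = (\<Sum>j | j dvd n. if j = k then totient k * (k ^ (n div k) * fact (n div k)) else 0)"
    by (intro sum.cong) auto
  also have "\<dots> = totient k * (k ^ (n div k) * fact (n div k))"
    using assms(1,4) by (simp add: sum.delta)
  finally show ?thesis .
qed

section \<open>The rotation group and its action\<close>

lemma rho_in_n_cycles: "rho n \<in> n_cycles n"
  using rho_in_sym_group[of n] unfolding n_cycles_def rho_def
  by (auto intro!: exI[of _ "[1..<Suc n]"] simp del: upt_Suc)

lemma rho_permutes: "rho n permutes {1..n}"
  using rho_in_sym_group by (simp add: sym_group_carrier)

lemma uniform_cycles_rho_power:
  assumes "n > 0"
  shows "uniform_cycles (n div gcd n k) (rho n ^^ k) {1..n}"
  using n_cycle_uniform[OF rho_in_n_cycles assms] funpow_closed[of "rho n" "{1..n}" _ k]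
  by (simp add: uniform_cycles_def funpow_mult dvd_mult_iff_div_gcd_dvd[OF assms] mult.commute)

lemma sym_group_pow: "p [^]\<^bsub>sym_group n\<^esub> (k :: nat) = p ^^ k"
  by (induction k) (simp_all add: nat_pow_def sym_group_def funpow_swap1 fun_eq_iff)

lemma carrier_rotation_group:
  assumes "n > 0"
  shows "bij_betw (\<lambda>k. rho n ^^ k) {..<n} (carrier (rotation_group n))"
proof (rule bij_betw_imageI)
  interpret S: group "sym_group n" by (rule sym_group_is_group)
  note eq = funpow_eq_iff_mod[OF n_cycle_uniform[OF rho_in_n_cycles assms] assms]
  have "carrier (sym_group n) = {p. p permutes {1..n}}" by (simp add: sym_group_def)
  then have "finite (carrier (sym_group n))" by (simp add: finite_permutations)
  then have carrier: "carrier (rotation_group n) = range (\<lambda>k. rho n ^^ k)"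
    using S.generate_pow_on_finite_carrier[OF _ rho_in_sym_group]
    by (auto simp: rotation_group_def sym_group_pow)
  show "inj_on (\<lambda>k. rho n ^^ k) {..<n}"
  proof (rule inj_onI)
    fix i k assume ik: "i \<in> {..<n}" "k \<in> {..<n}" and "rho n ^^ i = rho n ^^ k"
    then have "i mod n = k mod n" using eq[of 1 i k] assms by simp
    then show "i = k" using ik by simp
  qed
  show "(\<lambda>k. rho n ^^ k) ` {..<n} = carrier (rotation_group n)"
  proof (intro subset_antisym subsetI)
    fix p assume "p \<in> carrier (rotation_group n)"
    then obtain k where k: "p = rho n ^^ k" by (auto simp: carrier)
    have "(rho n ^^ k) x = (rho n ^^ (k mod n)) x" for x
    proof (cases "x \<in> {1..n}")
      case True
      then show ?thesis using eq[of x k "k mod n"] by simp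
    next
      case False
      then show ?thesis using permutes_not_in[OF permutes_funpow[OF rho_permutes]] by metis
    qed
    then have "p = rho n ^^ (k mod n)" by (simp add: k fun_eq_iff)
    then show "p \<in> (\<lambda>k. rho n ^^ k) ` {..<n}" using assms by simp
  qed (auto simp: carrier)
qed

lemma invariants_conj_action:
  assumes "g permutes {1..n}"
  shows "invariants (n_cycles n) (conj_action n) g = {c \<in> n_cycles n. g \<circ> c = c \<circ> g}"
proof -
  interpret S: group "sym_group n" by (rule sym_group_is_group)
  have g: "g \<in> carrier (sym_group n)" using assms by (simp add: sym_group_carrier)
  have "conj_action n g c = c \<longleftrightarrow> g \<circ> c = c \<circ> g" if c: "c \<in> n_cycles n" for c
  proof -
    have cS: "c \<in> carrier (sym_group n)" using c by (simp add: n_cycles_def)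
    have "conj_action n g c = c \<longleftrightarrow> g \<otimes>\<^bsub>sym_group n\<^esub> c = c \<otimes>\<^bsub>sym_group n\<^esub> g"
      using c g cS S.inv_solve_right'[of c "g \<otimes>\<^bsub>sym_group n\<^esub> c" g]
      by (auto simp add: conj_action_def simp del: sym_group_inv_equality)
    then show ?thesis by (simp add: sym_group_mult)
  qed
  then show ?thesis by (auto simp: invariants_def)
qed

theorem theorem3p2:
  fixes n :: nat
  assumes "n \<ge> 2"
  shows "real (num_types n) =
    1 / real n ^ 2 * (\<Sum>j | j dvd n. real (totient j) ^ 2 * real j ^ (n div j) * fact (n div j))"
proof -
  have n: "n > 0" using assms by simp
  interpret A: group_action "rotation_group n" "n_cycles n" "conj_action n"
    by (rule conj_action_is_group_action)
  note bij = carrier_rotation_group[OF n]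
  let ?fix = "\<lambda>g. card {c \<in> n_cycles n. g \<circ> c = c \<circ> g}"
  let ?w = "\<lambda>j. totient j * (j ^ (n div j) * fact (n div j))"
  have "num_types n * n = num_types n * order (rotation_group n)"
    using bij_betw_same_card[OF bij] by (simp add: order_def)
  also have "\<dots> = (\<Sum>g\<in>carrier (rotation_group n). card (invariants (n_cycles n) (conj_action n) g))"
    unfolding num_types_def combinatorial_types_def
    using bij_betw_finite[OF bij] finite_n_cycles by (intro A.burnside) auto
  also have "\<dots> = (\<Sum>k<n. card (invariants (n_cycles n) (conj_action n) (rho n ^^ k)))"
    by (rule sum.reindex_bij_betw[OF bij, symmetric])
  also have "\<dots> = (\<Sum>k<n. ?fix (rho n ^^ k))"
    by (simp only: invariants_conj_action[OF permutes_funpow[OF rho_permutes]])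
  finally have "n ^ 2 * num_types n = (\<Sum>k<n. n * ?fix (rho n ^^ k))"
    by (simp add: power2_eq_square sum_distrib_left mult_ac)
  also have "\<dots> = (\<Sum>k<n. ?w (n div gcd n k))"
    by (intro sum.cong refl card_commuting_n_cycles_uniform n permutes_funpow rho_permutes
        uniform_cycles_rho_power) (simp_all add: div_dvd_self n)
  also have "\<dots> = (\<Sum>j | j dvd n. totient j * ?w j)"
    using sum_residues_by_order[OF n, of ?w] by simp
  finally have "real (n ^ 2 * num_types n) = real (\<Sum>j | j dvd n. totient j * ?w j)" by simp
  then have "real n ^ 2 * real (num_types n) =
      (\<Sum>j | j dvd n. real (totient j) ^ 2 * real j ^ (n div j) * fact (n div j))"
    by (simp add: power2_eq_square mult_ac)
  then show ?thesis using n by (simp add: field_simps)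
qed

end
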